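(* Let $R$ be a principal ideal domain and let $(A,m)$ be a $2$-dimensional commutative associative $R$-algebra whose multiplication $m: A\otimes_R A\to A$ is surjective. Then $A$ is unital.
   Context: Algebras are not assumed to have an identity element; an $R$-algebra is an $R$-module $A$ with an $R$-linear map $m: A\otimes_R A\to A$, and it is called unital if it has an identity element for $m$. A $2$-dimensional (rank-$2$) $R$-algebra is one whose underlying $R$-module is free of rank $2$. *)

theory Defs
  imports "HOL-Algebra.Module" "HOL-Algebra.AbelCoset" "HOL-Algebra.Ring_Divisibility"
begin

text \<open>
  \<^const>\<open>module\<close> records extend ring records, so the fields \<^const>\<open>mult\<close> and \<^const>\<open>one\<close> of a module
  carry no information; they are left \<^const>\<open>undefined\<close> in the constructions below. Since the
  locale \<^locale>\<open>algebra\<close> requires a commutative unital ring, it is not used here: the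
  multiplication of an algebra is a separate linear map.
\<close>

definition linear_maps ::
    "('r, 'k) ring_scheme \<Rightarrow> ('r, 'a, 'l) module_scheme \<Rightarrow> ('r, 'b, 'm) module_scheme \<Rightarrow> ('a \<Rightarrow> 'b) set" where
  "linear_maps R M N =
    {f \<in> carrier M \<rightarrow> carrier N.
      (\<forall>x\<in>carrier M. \<forall>y\<in>carrier M. f (x \<oplus>\<^bsub>M\<^esub> y) = f x \<oplus>\<^bsub>N\<^esub> f y) \<and>
      (\<forall>a\<in>carrier R. \<forall>x\<in>carrier M. f (a \<odot>\<^bsub>M\<^esub> x) = a \<odot>\<^bsub>N\<^esub> f x)}"

text \<open>
  Coefficient families are extensional on the basis, so that \<open>\<exists>!\<close> is uniqueness of coordinates.
\<close>

definition free_of_rank :: "('r, 'k) ring_scheme \<Rightarrow> ('r, 'a, 'l) module_scheme \<Rightarrow> nat \<Rightarrow> bool" where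
  "free_of_rank R M n \<longleftrightarrow>
    (\<exists>B. B \<subseteq> carrier M \<and> finite B \<and> card B = n \<and>
      (\<forall>x\<in>carrier M. \<exists>!c. c \<in> B \<rightarrow>\<^sub>E carrier R \<and> x = (\<Oplus>\<^bsub>M\<^esub>b\<in>B. c b \<odot>\<^bsub>M\<^esub> b)))"

definition free_module :: "('r, 'k) ring_scheme \<Rightarrow> 's set \<Rightarrow> ('r, 's \<Rightarrow> 'r) module" where
  "free_module R S =
    \<lparr>carrier = {f. f \<in> S \<rightarrow> carrier R \<and> (\<forall>s. s \<notin> S \<longrightarrow> f s = \<zero>\<^bsub>R\<^esub>) \<and> finite {s. f s \<noteq> \<zero>\<^bsub>R\<^esub>}},
     mult = undefined, one = undefined,
     zero = (\<lambda>s. \<zero>\<^bsub>R\<^esub>), add = (\<lambda>f g s. f s \<oplus>\<^bsub>R\<^esub> g s),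
     smult = (\<lambda>a f s. a \<otimes>\<^bsub>R\<^esub> f s)\<rparr>"

definition free_gen :: "('r, 'k) ring_scheme \<Rightarrow> 's \<Rightarrow> 's \<Rightarrow> 'r" where
  "free_gen R s = (\<lambda>t. if t = s then \<one>\<^bsub>R\<^esub> else \<zero>\<^bsub>R\<^esub>)"

definition submodule_span :: "('r, 'k) ring_scheme \<Rightarrow> ('r, 'a, 'l) module_scheme \<Rightarrow> 'a set \<Rightarrow> 'a set" where
  "submodule_span R M X = \<Inter>{H. submodule H R M \<and> X \<subseteq> H}"

text \<open>
  In the scalar multiplication below all members of the union are the same coset.
\<close>

definition quotient_module :: "('r, 'a, 'l) module_scheme \<Rightarrow> 'a set \<Rightarrow> ('r, 'a set) module" where
  "quotient_module M H =
    \<lparr>carrier = a_rcosets\<^bsub>M\<^esub> H, mult = undefined, one = undefined,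
     zero = H, add = set_add M,
     smult = (\<lambda>a X. \<Union>x\<in>X. H +>\<^bsub>M\<^esub> (a \<odot>\<^bsub>M\<^esub> x))\<rparr>"

definition tensor_relations ::
    "('r, 'k) ring_scheme \<Rightarrow> ('r, 'a, 'l) module_scheme \<Rightarrow> ('r, 'b, 'm) module_scheme \<Rightarrow> ('a \<times> 'b \<Rightarrow> 'r) set" where
  "tensor_relations R M N =
    (let F = free_module R (carrier M \<times> carrier N); g = (\<lambda>x y. free_gen R (x, y)) in
      {g (x \<oplus>\<^bsub>M\<^esub> x') y \<ominus>\<^bsub>F\<^esub> (g x y \<oplus>\<^bsub>F\<^esub> g x' y) | x x' y.
        x \<in> carrier M \<and> x' \<in> carrier M \<and> y \<in> carrier N} \<union>
      {g x (y \<oplus>\<^bsub>N\<^esub> y') \<ominus>\<^bsub>F\<^esub> (g x y \<oplus>\<^bsub>F\<^esub> g x y') | x y y'.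
        x \<in> carrier M \<and> y \<in> carrier N \<and> y' \<in> carrier N} \<union>
      {g (a \<odot>\<^bsub>M\<^esub> x) y \<ominus>\<^bsub>F\<^esub> (a \<odot>\<^bsub>F\<^esub> g x y) | a x y.
        a \<in> carrier R \<and> x \<in> carrier M \<and> y \<in> carrier N} \<union>
      {g x (a \<odot>\<^bsub>N\<^esub> y) \<ominus>\<^bsub>F\<^esub> (a \<odot>\<^bsub>F\<^esub> g x y) | a x y.
        a \<in> carrier R \<and> x \<in> carrier M \<and> y \<in> carrier N})"

definition tensor_kernel ::
    "('r, 'k) ring_scheme \<Rightarrow> ('r, 'a, 'l) module_scheme \<Rightarrow> ('r, 'b, 'm) module_scheme \<Rightarrow> ('a \<times> 'b \<Rightarrow> 'r) set" where
  "tensor_kernel R M N =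
    submodule_span R (free_module R (carrier M \<times> carrier N)) (tensor_relations R M N)"

definition tensor_product ::
    "('r, 'k) ring_scheme \<Rightarrow> ('r, 'a, 'l) module_scheme \<Rightarrow> ('r, 'b, 'm) module_scheme \<Rightarrow>
      ('r, ('a \<times> 'b \<Rightarrow> 'r) set) module" where
  "tensor_product R M N =
    quotient_module (free_module R (carrier M \<times> carrier N)) (tensor_kernel R M N)"

definition pure_tensor ::
    "('r, 'k) ring_scheme \<Rightarrow> ('r, 'a, 'l) module_scheme \<Rightarrow> ('r, 'b, 'm) module_scheme \<Rightarrow>
      'a \<Rightarrow> 'b \<Rightarrow> ('a \<times> 'b \<Rightarrow> 'r) set" where
  "pure_tensor R M N x y =
    tensor_kernel R M N +>\<^bsub>free_module R (carrier M \<times> carrier N)\<^esub> free_gen R (x, y)"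

locale general_algebra = module R A
  for R :: "('r, 'k) ring_scheme" (structure) and A :: "('r, 'a, 'l) module_scheme" (structure) +
  fixes m :: "('a \<times> 'a \<Rightarrow> 'r) set \<Rightarrow> 'a"
  assumes mult_linear: "m \<in> linear_maps R (tensor_product R A A) A"

definition commutative_algebra ::
    "('r, 'k) ring_scheme \<Rightarrow> ('r, 'a, 'l) module_scheme \<Rightarrow> (('a \<times> 'a \<Rightarrow> 'r) set \<Rightarrow> 'a) \<Rightarrow> bool" where
  "commutative_algebra R A m \<longleftrightarrow>
    (\<forall>x\<in>carrier A. \<forall>y\<in>carrier A. m (pure_tensor R A A x y) = m (pure_tensor R A A y x))"

definition associative_algebra ::
    "('r, 'k) ring_scheme \<Rightarrow> ('r, 'a, 'l) module_scheme \<Rightarrow> (('a \<times> 'a \<Rightarrow> 'r) set \<Rightarrow> 'a) \<Rightarrow> bool" where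
  "associative_algebra R A m \<longleftrightarrow>
    (\<forall>x\<in>carrier A. \<forall>y\<in>carrier A. \<forall>z\<in>carrier A.
      m (pure_tensor R A A (m (pure_tensor R A A x y)) z) =
      m (pure_tensor R A A x (m (pure_tensor R A A y z))))"

definition unital_algebra ::
    "('r, 'k) ring_scheme \<Rightarrow> ('r, 'a, 'l) module_scheme \<Rightarrow> (('a \<times> 'a \<Rightarrow> 'r) set \<Rightarrow> 'a) \<Rightarrow> bool" where
  "unital_algebra R A m \<longleftrightarrow>
    (\<exists>e\<in>carrier A. \<forall>x\<in>carrier A.
      m (pure_tensor R A A e x) = x \<and> m (pure_tensor R A A x e) = x)"

text \<open>
  The quotient is an \<open>R\<close>-module, \<^const>\<open>pure_tensor\<close> is bilinear, and every bilinear map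
  factors through it.
\<close>

lemma module_free_module:
  fixes S :: "'s set"
  assumes "cring R" shows "module R (free_module R S)"
proof -
  interpret cring R by fact
  let ?F = "free_module R S"
  have fin_add: "finite {s. f s \<oplus>\<^bsub>R\<^esub> g s \<noteq> \<zero>\<^bsub>R\<^esub>}"
    if "finite {s. f s \<noteq> \<zero>\<^bsub>R\<^esub>}" "finite {s. g s \<noteq> \<zero>\<^bsub>R\<^esub>}" for f g :: "'s \<Rightarrow> 'a"
    by (rule finite_subset[OF _ finite_UnI[OF that]]) auto
  have car: "f s \<in> carrier R" if "f \<in> carrier ?F" for f s
    using that by (cases "s \<in> S") (auto simp: free_module_def)
  have closed: "f \<oplus>\<^bsub>?F\<^esub> g \<in> carrier ?F" if "f \<in> carrier ?F" "g \<in> carrier ?F" for f g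
    using that fin_add by (auto simp: free_module_def)
  have "abelian_group ?F"
  proof (rule abelian_groupI)
    fix f assume f: "f \<in> carrier ?F"
    then have "{s. \<ominus>\<^bsub>R\<^esub> f s \<noteq> \<zero>\<^bsub>R\<^esub>} \<subseteq> {s. f s \<noteq> \<zero>\<^bsub>R\<^esub>}" by auto
    with f have "finite {s. \<ominus>\<^bsub>R\<^esub> f s \<noteq> \<zero>\<^bsub>R\<^esub>}"
      by (rule_tac finite_subset) (auto simp: free_module_def)
    with f have "(\<lambda>s. \<ominus>\<^bsub>R\<^esub> f s) \<in> carrier ?F" "(\<lambda>s. \<ominus>\<^bsub>R\<^esub> f s) \<oplus>\<^bsub>?F\<^esub> f = \<zero>\<^bsub>?F\<^esub>"
      using car[OF f] by (auto simp: free_module_def l_neg)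
    then show "\<exists>g\<in>carrier ?F. g \<oplus>\<^bsub>?F\<^esub> f = \<zero>\<^bsub>?F\<^esub>" by blast
  next
    fix f g assume fg: "f \<in> carrier ?F" "g \<in> carrier ?F"
    then show "f \<oplus>\<^bsub>?F\<^esub> g \<in> carrier ?F" by (rule closed)
    show "f \<oplus>\<^bsub>?F\<^esub> g = g \<oplus>\<^bsub>?F\<^esub> f"
      using fg[THEN car] by (simp add: free_module_def a_comm)
    fix h assume "h \<in> carrier ?F"
    note fgh = fg[THEN car] this[THEN car]
    show "f \<oplus>\<^bsub>?F\<^esub> g \<oplus>\<^bsub>?F\<^esub> h = f \<oplus>\<^bsub>?F\<^esub> (g \<oplus>\<^bsub>?F\<^esub> h)"
      using fgh by (simp add: free_module_def a_assoc)
  next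
    fix f assume "f \<in> carrier ?F"
    then show "\<zero>\<^bsub>?F\<^esub> \<oplus>\<^bsub>?F\<^esub> f = f" using car[of f] by (simp add: free_module_def)
  next
    show "\<zero>\<^bsub>?F\<^esub> \<in> carrier ?F" by (simp add: free_module_def)
  qed
  then show ?thesis
  proof (rule moduleI[OF assms])
    fix a f assume *: "a \<in> carrier R" "f \<in> carrier ?F"
    then have "{s. a \<otimes>\<^bsub>R\<^esub> f s \<noteq> \<zero>\<^bsub>R\<^esub>} \<subseteq> {s. f s \<noteq> \<zero>\<^bsub>R\<^esub>}" by auto
    with * show "a \<odot>\<^bsub>?F\<^esub> f \<in> carrier ?F"
      using finite_subset[of "{s. a \<otimes>\<^bsub>R\<^esub> f s \<noteq> \<zero>\<^bsub>R\<^esub>}" "{s. f s \<noteq> \<zero>\<^bsub>R\<^esub>}"]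
      by (auto simp: free_module_def)
  next
    fix a b f assume *: "a \<in> carrier R" "b \<in> carrier R" "f \<in> carrier ?F"
    note * = *(1,2) *(3)[THEN car]
    show "(a \<oplus>\<^bsub>R\<^esub> b) \<odot>\<^bsub>?F\<^esub> f = a \<odot>\<^bsub>?F\<^esub> f \<oplus>\<^bsub>?F\<^esub> b \<odot>\<^bsub>?F\<^esub> f"
      using * by (simp add: free_module_def l_distr)
    show "(a \<otimes>\<^bsub>R\<^esub> b) \<odot>\<^bsub>?F\<^esub> f = a \<odot>\<^bsub>?F\<^esub> (b \<odot>\<^bsub>?F\<^esub> f)"
      using * by (simp add: free_module_def m_assoc)
  next
    fix a f g assume *: "a \<in> carrier R" "f \<in> carrier ?F" "g \<in> carrier ?F"
    note * = *(1) *(2,3)[THEN car]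
    show "a \<odot>\<^bsub>?F\<^esub> (f \<oplus>\<^bsub>?F\<^esub> g) = a \<odot>\<^bsub>?F\<^esub> f \<oplus>\<^bsub>?F\<^esub> a \<odot>\<^bsub>?F\<^esub> g"
      using * by (simp add: free_module_def r_distr)
  next
    fix f assume "f \<in> carrier ?F"
    then show "\<one>\<^bsub>R\<^esub> \<odot>\<^bsub>?F\<^esub> f = f" using car[of f] by (simp add: free_module_def)
  qed
qed

lemma free_gen_closed:
  assumes "cring R" "s \<in> S" shows "free_gen R s \<in> carrier (free_module R S)"
proof -
  interpret cring R by fact
  show ?thesis using assms(2) by (auto simp: free_module_def free_gen_def)
qed

lemma submodule_submodule_span:
  assumes "module R M" "X \<subseteq> carrier M" shows "submodule (submodule_span R M X) R M"
proof -
  interpret module R M by fact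
  have "carrier M \<in> {H. submodule H R M \<and> X \<subseteq> H}"
    using carrier_is_submodule assms(2) by auto
  then show ?thesis unfolding submodule_span_def
    by (intro submoduleI) (blast dest: submoduleE(1,3,4,5) subgroup.one_closed[OF submodule.axioms(1), simplified] submodule.axioms(1))+
qed

lemma
  assumes "module R M" "submodule H R M"
  shows module_quotient_module: "module R (quotient_module M H)"
    and quotient_add: "\<And>x y. \<lbrakk>x \<in> carrier M; y \<in> carrier M\<rbrakk> \<Longrightarrow>
      (H +>\<^bsub>M\<^esub> x) \<oplus>\<^bsub>quotient_module M H\<^esub> (H +>\<^bsub>M\<^esub> y) = H +>\<^bsub>M\<^esub> (x \<oplus>\<^bsub>M\<^esub> y)"
    and quotient_smult: "\<And>a x. \<lbrakk>a \<in> carrier R; x \<in> carrier M\<rbrakk> \<Longrightarrow>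
      a \<odot>\<^bsub>quotient_module M H\<^esub> (H +>\<^bsub>M\<^esub> x) = H +>\<^bsub>M\<^esub> (a \<odot>\<^bsub>M\<^esub> x)"
proof -
  interpret module R M by fact
  interpret submodule H R M by fact
  let ?Q = "quotient_module M H"
  interpret S: abelian_subgroup H M
    by (rule abelian_subgroupI3) (auto simp: additive_subgroup_def subgroup_axioms M.abelian_group_axioms)
  have hsub: "h \<in> carrier M" if "h \<in> H" for h using that subset by auto
  show add: "(H +>\<^bsub>M\<^esub> x) \<oplus>\<^bsub>?Q\<^esub> (H +>\<^bsub>M\<^esub> y) = H +>\<^bsub>M\<^esub> (x \<oplus>\<^bsub>M\<^esub> y)"
    if "x \<in> carrier M" "y \<in> carrier M" for x y
    using that by (simp add: quotient_module_def S.a_rcos_sum)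
  show sm: "a \<odot>\<^bsub>?Q\<^esub> (H +>\<^bsub>M\<^esub> x) = H +>\<^bsub>M\<^esub> (a \<odot>\<^bsub>M\<^esub> x)"
    if "a \<in> carrier R" "x \<in> carrier M" for a x
  proof -
    have coset: "H +>\<^bsub>M\<^esub> (a \<odot>\<^bsub>M\<^esub> y) = H +>\<^bsub>M\<^esub> (a \<odot>\<^bsub>M\<^esub> x)" if y: "y \<in> H +>\<^bsub>M\<^esub> x" for y
    proof -
      obtain h where h: "h \<in> H" "y = h \<oplus>\<^bsub>M\<^esub> x" using y by (auto simp: a_r_coset_def r_coset_def)
      have "a \<odot>\<^bsub>M\<^esub> y \<in> H +>\<^bsub>M\<^esub> (a \<odot>\<^bsub>M\<^esub> x)"
        using h hsub \<open>a \<in> carrier R\<close> \<open>x \<in> carrier M\<close>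
        by (auto simp: a_r_coset_def r_coset_def smult_r_distr)
      from M.a_repr_independence[OF this _ subgroup_axioms, symmetric] show ?thesis
        using \<open>a \<in> carrier R\<close> \<open>x \<in> carrier M\<close> by simp
    qed
    have x: "x \<in> H +>\<^bsub>M\<^esub> x" using that by (simp add: S.a_rcos_self)
    have "(\<Union>y\<in>H +>\<^bsub>M\<^esub> x. H +>\<^bsub>M\<^esub> (a \<odot>\<^bsub>M\<^esub> y)) = (\<Union>y\<in>H +>\<^bsub>M\<^esub> x. H +>\<^bsub>M\<^esub> (a \<odot>\<^bsub>M\<^esub> x))"
      by (rule SUP_cong[OF refl coset])
    also have "\<dots> = H +>\<^bsub>M\<^esub> (a \<odot>\<^bsub>M\<^esub> x)" using x by blast
    finally show ?thesis by (simp add: quotient_module_def)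
  qed
  have repr: "\<exists>x\<in>carrier M. X = H +>\<^bsub>M\<^esub> x" if "X \<in> carrier ?Q" for X
    using that by (auto simp: quotient_module_def A_RCOSETS_def RCOSETS_def a_r_coset_def)
  have cl: "H +>\<^bsub>M\<^esub> x \<in> carrier ?Q" if "x \<in> carrier M" for x
    using that by (auto simp: quotient_module_def A_RCOSETS_def RCOSETS_def a_r_coset_def)
  have z: "\<zero>\<^bsub>?Q\<^esub> = H +>\<^bsub>M\<^esub> \<zero>\<^bsub>M\<^esub>"
    using hsub by (force simp: quotient_module_def a_r_coset_def r_coset_def)
  have "abelian_group ?Q"
  proof (rule abelian_groupI)
    fix X assume "X \<in> carrier ?Q"
    then obtain x where x: "x \<in> carrier M" "X = H +>\<^bsub>M\<^esub> x" using repr by blast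
    then show "\<exists>Y\<in>carrier ?Q. Y \<oplus>\<^bsub>?Q\<^esub> X = \<zero>\<^bsub>?Q\<^esub>"
      by (intro bexI[of _ "H +>\<^bsub>M\<^esub> (\<ominus>\<^bsub>M\<^esub> x)"]) (auto simp: add z cl M.l_neg)
  next
    fix X Y assume "X \<in> carrier ?Q" "Y \<in> carrier ?Q"
    then obtain x y where xy: "x \<in> carrier M" "X = H +>\<^bsub>M\<^esub> x" "y \<in> carrier M" "Y = H +>\<^bsub>M\<^esub> y"
      using repr by meson
    show "X \<oplus>\<^bsub>?Q\<^esub> Y \<in> carrier ?Q" using xy by (simp add: add cl)
    show "X \<oplus>\<^bsub>?Q\<^esub> Y = Y \<oplus>\<^bsub>?Q\<^esub> X" using xy by (simp add: add M.a_comm)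
    fix Z assume "Z \<in> carrier ?Q"
    then obtain w where "w \<in> carrier M" "Z = H +>\<^bsub>M\<^esub> w" using repr by blast
    then show "X \<oplus>\<^bsub>?Q\<^esub> Y \<oplus>\<^bsub>?Q\<^esub> Z = X \<oplus>\<^bsub>?Q\<^esub> (Y \<oplus>\<^bsub>?Q\<^esub> Z)"
      using xy by (simp add: add M.a_assoc)
  next
    fix X assume "X \<in> carrier ?Q"
    then obtain x where "x \<in> carrier M" "X = H +>\<^bsub>M\<^esub> x" using repr by blast
    then show "\<zero>\<^bsub>?Q\<^esub> \<oplus>\<^bsub>?Q\<^esub> X = X" by (simp add: add z)
  next
    show "\<zero>\<^bsub>?Q\<^esub> \<in> carrier ?Q" by (simp add: cl z)
  qed
  then show "module R ?Q"
  proof (rule moduleI[OF is_cring])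
    fix a b X assume *: "a \<in> carrier R" "b \<in> carrier R" "X \<in> carrier ?Q"
    then obtain x where x: "x \<in> carrier M" "X = H +>\<^bsub>M\<^esub> x" using repr by blast
    show "(a \<oplus>\<^bsub>R\<^esub> b) \<odot>\<^bsub>?Q\<^esub> X = a \<odot>\<^bsub>?Q\<^esub> X \<oplus>\<^bsub>?Q\<^esub> b \<odot>\<^bsub>?Q\<^esub> X"
      using * x by (simp add: add sm smult_l_distr)
    show "(a \<otimes>\<^bsub>R\<^esub> b) \<odot>\<^bsub>?Q\<^esub> X = a \<odot>\<^bsub>?Q\<^esub> (b \<odot>\<^bsub>?Q\<^esub> X)"
      using * x by (simp add: sm smult_assoc1)
  next
    fix a X assume *: "a \<in> carrier R" "X \<in> carrier ?Q"
    then obtain x where x: "x \<in> carrier M" "X = H +>\<^bsub>M\<^esub> x" using repr by blast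
    show "a \<odot>\<^bsub>?Q\<^esub> X \<in> carrier ?Q" using * x by (simp add: sm cl)
    fix Y assume "Y \<in> carrier ?Q"
    then obtain y where y: "y \<in> carrier M" "Y = H +>\<^bsub>M\<^esub> y" using repr by blast
    show "a \<odot>\<^bsub>?Q\<^esub> (X \<oplus>\<^bsub>?Q\<^esub> Y) = a \<odot>\<^bsub>?Q\<^esub> X \<oplus>\<^bsub>?Q\<^esub> a \<odot>\<^bsub>?Q\<^esub> Y"
      using * x y by (simp add: add sm smult_r_distr)
  next
    fix X assume "X \<in> carrier ?Q"
    then obtain x where x: "x \<in> carrier M" "X = H +>\<^bsub>M\<^esub> x" using repr by blast
    then show "\<one>\<^bsub>R\<^esub> \<odot>\<^bsub>?Q\<^esub> X = X" by (simp add: sm)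
  qed
qed


lemma linear_mapsD:
  assumes "f \<in> linear_maps R M N"
  shows "x \<in> carrier M \<Longrightarrow> f x \<in> carrier N"
    and "\<lbrakk>x \<in> carrier M; y \<in> carrier M\<rbrakk> \<Longrightarrow> f (x \<oplus>\<^bsub>M\<^esub> y) = f x \<oplus>\<^bsub>N\<^esub> f y"
    and "\<lbrakk>a \<in> carrier R; x \<in> carrier M\<rbrakk> \<Longrightarrow> f (a \<odot>\<^bsub>M\<^esub> x) = a \<odot>\<^bsub>N\<^esub> f x"
  using assms by (auto simp: linear_maps_def)

lemma tensor_relations_subset:
  assumes "module R M" "module R N"
  shows "tensor_relations R M N \<subseteq> carrier (free_module R (carrier M \<times> carrier N))"
proof -
  interpret M: module R M by fact
  interpret N: module R N by fact
  let ?F = "free_module R (carrier M \<times> carrier N)"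
  interpret F: module R ?F by (rule module_free_module) (rule M.R.is_cring)
  have g: "free_gen R (x, y) \<in> carrier ?F" if "x \<in> carrier M" "y \<in> carrier N" for x y
    using that by (intro free_gen_closed M.R.is_cring) auto
  show ?thesis unfolding tensor_relations_def Let_def
  proof (rule subsetI, elim UnE CollectE exE conjE, simp_all only:)
  qed (intro F.M.minus_closed F.M.a_closed F.smult_closed g
      M.M.a_closed N.M.a_closed M.smult_closed N.smult_closed; assumption)+
qed

lemma submodule_tensor_kernel:
  assumes "module R M" "module R N"
  shows "submodule (tensor_kernel R M N) R (free_module R (carrier M \<times> carrier N))"
  unfolding tensor_kernel_def
  using assms by (intro submodule_submodule_span tensor_relations_subset module_free_module)
    (auto simp: module_def)

lemma module_tensor_product:
  assumes "module R M" "module R N" shows "module R (tensor_product R M N)"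
  unfolding tensor_product_def
  using assms by (intro module_quotient_module submodule_tensor_kernel module_free_module)
    (auto simp: module_def)

lemma
  assumes "module R M" "module R N"
  shows pure_tensor_closed:
      "\<lbrakk>x \<in> carrier M; y \<in> carrier N\<rbrakk> \<Longrightarrow> pure_tensor R M N x y \<in> carrier (tensor_product R M N)"
    and pure_tensor_add_left: "\<lbrakk>x \<in> carrier M; x' \<in> carrier M; y \<in> carrier N\<rbrakk> \<Longrightarrow>
      pure_tensor R M N (x \<oplus>\<^bsub>M\<^esub> x') y =
        pure_tensor R M N x y \<oplus>\<^bsub>tensor_product R M N\<^esub> pure_tensor R M N x' y"
    and pure_tensor_add_right: "\<lbrakk>x \<in> carrier M; y \<in> carrier N; y' \<in> carrier N\<rbrakk> \<Longrightarrow>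
      pure_tensor R M N x (y \<oplus>\<^bsub>N\<^esub> y') =
        pure_tensor R M N x y \<oplus>\<^bsub>tensor_product R M N\<^esub> pure_tensor R M N x y'"
    and pure_tensor_smult_left: "\<lbrakk>a \<in> carrier R; x \<in> carrier M; y \<in> carrier N\<rbrakk> \<Longrightarrow>
      pure_tensor R M N (a \<odot>\<^bsub>M\<^esub> x) y = a \<odot>\<^bsub>tensor_product R M N\<^esub> pure_tensor R M N x y"
    and pure_tensor_smult_right: "\<lbrakk>a \<in> carrier R; x \<in> carrier M; y \<in> carrier N\<rbrakk> \<Longrightarrow>
      pure_tensor R M N x (a \<odot>\<^bsub>N\<^esub> y) = a \<odot>\<^bsub>tensor_product R M N\<^esub> pure_tensor R M N x y"
proof -
  interpret M: module R M by fact
  interpret N: module R N by fact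
  let ?F = "free_module R (carrier M \<times> carrier N)"
  let ?K = "tensor_kernel R M N"
  interpret F: module R ?F by (rule module_free_module) (rule M.R.is_cring)
  have sK: "submodule ?K R ?F" using assms by (rule submodule_tensor_kernel)
  interpret K: submodule ?K R ?F by (rule sK)
  interpret S: abelian_subgroup ?K ?F
    by (rule abelian_subgroupI3)
       (auto simp: additive_subgroup_def K.subgroup_axioms F.M.abelian_group_axioms)
  have g: "free_gen R (x, y) \<in> carrier ?F" if "x \<in> carrier M" "y \<in> carrier N" for x y
    using that by (intro free_gen_closed M.R.is_cring) auto
  have rel: "tensor_relations R M N \<subseteq> ?K"
    by (auto simp: tensor_kernel_def submodule_span_def)
  have eq: "?K +>\<^bsub>?F\<^esub> u = ?K +>\<^bsub>?F\<^esub> v"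
    if "u \<ominus>\<^bsub>?F\<^esub> v \<in> tensor_relations R M N" "u \<in> carrier ?F" "v \<in> carrier ?F" for u v
  proof -
    have "u = (u \<ominus>\<^bsub>?F\<^esub> v) \<oplus>\<^bsub>?F\<^esub> v"
      using that(2,3) by (simp add: a_minus_def F.M.a_assoc F.M.l_neg)
    then have "u \<in> ?K +>\<^bsub>?F\<^esub> v" using that(1) rel by (auto simp: a_r_coset_def r_coset_def)
    then show ?thesis
      using F.M.a_repr_independence[OF _ that(3) K.subgroup_axioms] by metis
  qed
  note qa = quotient_add[OF F.module_axioms sK, folded tensor_product_def]
  note qs = quotient_smult[OF F.module_axioms sK, folded tensor_product_def]
  show "pure_tensor R M N x y \<in> carrier (tensor_product R M N)" if "x \<in> carrier M" "y \<in> carrier N"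
    using g[OF that] by (auto simp: pure_tensor_def tensor_product_def quotient_module_def
        A_RCOSETS_def RCOSETS_def a_r_coset_def)
  show "pure_tensor R M N (x \<oplus>\<^bsub>M\<^esub> x') y =
      pure_tensor R M N x y \<oplus>\<^bsub>tensor_product R M N\<^esub> pure_tensor R M N x' y"
    if "x \<in> carrier M" "x' \<in> carrier M" "y \<in> carrier N"
  proof -
    note c = g F.M.a_closed F.smult_closed M.M.a_closed N.M.a_closed M.smult_closed N.smult_closed
    show ?thesis unfolding pure_tensor_def using that
      by (subst qa, use that in \<open>simp add: g\<close>, use that in \<open>simp add: g\<close>)
        (rule eq, unfold tensor_relations_def Let_def, blast, (simp add: c)+)
  qed
  show "pure_tensor R M N x (y \<oplus>\<^bsub>N\<^esub> y') =
      pure_tensor R M N x y \<oplus>\<^bsub>tensor_product R M N\<^esub> pure_tensor R M N x y'"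
    if "x \<in> carrier M" "y \<in> carrier N" "y' \<in> carrier N"
  proof -
    note c = g F.M.a_closed F.smult_closed M.M.a_closed N.M.a_closed M.smult_closed N.smult_closed
    show ?thesis unfolding pure_tensor_def using that
      by (subst qa, use that in \<open>simp add: g\<close>, use that in \<open>simp add: g\<close>)
        (rule eq, unfold tensor_relations_def Let_def, blast, (simp add: c)+)
  qed
  show "pure_tensor R M N (a \<odot>\<^bsub>M\<^esub> x) y = a \<odot>\<^bsub>tensor_product R M N\<^esub> pure_tensor R M N x y"
    if "a \<in> carrier R" "x \<in> carrier M" "y \<in> carrier N"
  proof -
    note c = g F.M.a_closed F.smult_closed M.M.a_closed N.M.a_closed M.smult_closed N.smult_closed
    show ?thesis unfolding pure_tensor_def using that
      by (subst qs, use that in \<open>simp add: g\<close>, use that in \<open>simp add: g\<close>)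
        (rule eq, unfold tensor_relations_def Let_def, blast, (simp add: c)+)
  qed
  show "pure_tensor R M N x (a \<odot>\<^bsub>N\<^esub> y) = a \<odot>\<^bsub>tensor_product R M N\<^esub> pure_tensor R M N x y"
    if "a \<in> carrier R" "x \<in> carrier M" "y \<in> carrier N"
  proof -
    note c = g F.M.a_closed F.smult_closed M.M.a_closed N.M.a_closed M.smult_closed N.smult_closed
    show ?thesis unfolding pure_tensor_def using that
      by (subst qs, use that in \<open>simp add: g\<close>, use that in \<open>simp add: g\<close>)
        (rule eq, unfold tensor_relations_def Let_def, blast, (simp add: c)+)
  qed
qed

lemma free_module_lift:
  assumes "module R P" "b \<in> S \<rightarrow> carrier P"
  shows "\<exists>f\<in>linear_maps R (free_module R S) P. \<forall>s\<in>S. f (free_gen R s) = b s"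
proof -
  interpret P: module R P by fact
  let ?F = "free_module R S"
  define f where "f u = (\<Oplus>\<^bsub>P\<^esub>s\<in>{s. u s \<noteq> \<zero>\<^bsub>R\<^esub>}. u s \<odot>\<^bsub>P\<^esub> b s)" for u
  have f_eq: "f u = (\<Oplus>\<^bsub>P\<^esub>s\<in>T. u s \<odot>\<^bsub>P\<^esub> b s)"
    if "u \<in> carrier ?F" "{s. u s \<noteq> \<zero>\<^bsub>R\<^esub>} \<subseteq> T" "finite T" "T \<subseteq> S" for u T
    unfolding f_def
    by (rule P.M.add.finprod_mono_neutral_cong_left)
       (use that assms(2) in \<open>auto simp: free_module_def Pi_iff subset_iff\<close>)
  have car: "u s \<in> carrier R" if "u \<in> carrier ?F" for u s
    using that by (cases "s \<in> S") (auto simp: free_module_def)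
  have sup: "{s. u s \<noteq> \<zero>\<^bsub>R\<^esub>} \<subseteq> S \<and> finite {s. u s \<noteq> \<zero>\<^bsub>R\<^esub>}" if "u \<in> carrier ?F" for u
    using that by (auto simp: free_module_def)
  interpret F: module R ?F by (rule module_free_module) (rule P.R.is_cring)
  have bc: "b s \<in> carrier P" if "s \<in> S" for s using assms(2) that by auto
  have "f \<in> linear_maps R ?F P"
    unfolding linear_maps_def
  proof (safe)
    fix u assume u: "u \<in> carrier ?F"
    show "f u \<in> carrier P" unfolding f_def
      by (rule P.M.finsum_closed) (use sup[OF u] car[OF u] bc in auto)
    fix v assume v: "v \<in> carrier ?F"
    let ?T = "{s. u s \<noteq> \<zero>\<^bsub>R\<^esub>} \<union> {s. v s \<noteq> \<zero>\<^bsub>R\<^esub>}"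
    have uv: "u \<oplus>\<^bsub>?F\<^esub> v = (\<lambda>s. u s \<oplus>\<^bsub>R\<^esub> v s)" by (simp add: free_module_def)
    have T: "finite ?T" "?T \<subseteq> S" using sup[OF u] sup[OF v] by auto
    have "f (u \<oplus>\<^bsub>?F\<^esub> v) = (\<Oplus>\<^bsub>P\<^esub>s\<in>?T. (u \<oplus>\<^bsub>?F\<^esub> v) s \<odot>\<^bsub>P\<^esub> b s)"
      by (rule f_eq) (use u v T in \<open>auto simp: uv[symmetric]\<close>, auto simp: uv)
    also have "\<dots> = (\<Oplus>\<^bsub>P\<^esub>s\<in>?T. u s \<odot>\<^bsub>P\<^esub> b s \<oplus>\<^bsub>P\<^esub> v s \<odot>\<^bsub>P\<^esub> b s)"
      by (rule P.M.finsum_cong')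
         (use T car[OF u] car[OF v] bc in \<open>auto simp: uv P.smult_l_distr subset_iff\<close>)
    also have "\<dots> = f u \<oplus>\<^bsub>P\<^esub> f v"
      using T car[OF u] car[OF v] bc u v
      by (subst P.M.finsum_addf) (auto simp: Pi_iff f_eq[of _ ?T] subset_iff)
    finally show "f (u \<oplus>\<^bsub>?F\<^esub> v) = f u \<oplus>\<^bsub>P\<^esub> f v" .
  next
    fix a u assume a: "a \<in> carrier R" and u: "u \<in> carrier ?F"
    have au: "a \<odot>\<^bsub>?F\<^esub> u = (\<lambda>s. a \<otimes>\<^bsub>R\<^esub> u s)" by (simp add: free_module_def)
    let ?T = "{s. u s \<noteq> \<zero>\<^bsub>R\<^esub>}"
    have T: "finite ?T" "?T \<subseteq> S" using sup[OF u] by auto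
    have "f (a \<odot>\<^bsub>?F\<^esub> u) = (\<Oplus>\<^bsub>P\<^esub>s\<in>?T. (a \<odot>\<^bsub>?F\<^esub> u) s \<odot>\<^bsub>P\<^esub> b s)"
    proof (rule f_eq)
      show "{s. (a \<odot>\<^bsub>?F\<^esub> u) s \<noteq> \<zero>\<^bsub>R\<^esub>} \<subseteq> ?T" using a by (auto simp: au)
    qed (use a u T in auto)
    also have "\<dots> = (\<Oplus>\<^bsub>P\<^esub>s\<in>?T. a \<odot>\<^bsub>P\<^esub> (u s \<odot>\<^bsub>P\<^esub> b s))"
      by (rule P.M.finsum_cong')
         (use T a car[OF u] bc in \<open>auto simp: au P.smult_assoc1 subset_iff\<close>)
    also have "\<dots> = a \<odot>\<^bsub>P\<^esub> f u" unfolding f_def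
      by (rule P.finsum_smult_ldistr[symmetric]) (use T a car[OF u] bc in \<open>auto simp: subset_iff\<close>)
    finally show "f (a \<odot>\<^bsub>?F\<^esub> u) = a \<odot>\<^bsub>P\<^esub> f u" .
  qed
  moreover have "f (free_gen R s) = b s" if s: "s \<in> S" for s
  proof -
    have "f (free_gen R s) = (\<Oplus>\<^bsub>P\<^esub>t\<in>{s}. free_gen R s t \<odot>\<^bsub>P\<^esub> b t)"
      by (rule f_eq) (use s in \<open>auto simp: free_gen_closed P.R.is_cring\<close>, auto simp: free_gen_def split: if_splits)
    also have "\<dots> = b s"
      using bc[OF s] by (simp add: free_gen_def)
    finally show ?thesis .
  qed
  ultimately show ?thesis by blast
qed

theorem tensor_product_lift:
  assumes "module R M" "module R N" "module R P"
    and closed: "\<And>x y. \<lbrakk>x \<in> carrier M; y \<in> carrier N\<rbrakk> \<Longrightarrow> b x y \<in> carrier P"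
    and add_left: "\<And>x x' y. \<lbrakk>x \<in> carrier M; x' \<in> carrier M; y \<in> carrier N\<rbrakk> \<Longrightarrow>
      b (x \<oplus>\<^bsub>M\<^esub> x') y = b x y \<oplus>\<^bsub>P\<^esub> b x' y"
    and add_right: "\<And>x y y'. \<lbrakk>x \<in> carrier M; y \<in> carrier N; y' \<in> carrier N\<rbrakk> \<Longrightarrow>
      b x (y \<oplus>\<^bsub>N\<^esub> y') = b x y \<oplus>\<^bsub>P\<^esub> b x y'"
    and smult_left: "\<And>a x y. \<lbrakk>a \<in> carrier R; x \<in> carrier M; y \<in> carrier N\<rbrakk> \<Longrightarrow>
      b (a \<odot>\<^bsub>M\<^esub> x) y = a \<odot>\<^bsub>P\<^esub> b x y"
    and smult_right: "\<And>a x y. \<lbrakk>a \<in> carrier R; x \<in> carrier M; y \<in> carrier N\<rbrakk> \<Longrightarrow>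
      b x (a \<odot>\<^bsub>N\<^esub> y) = a \<odot>\<^bsub>P\<^esub> b x y"
  shows "\<exists>f\<in>linear_maps R (tensor_product R M N) P.
    \<forall>x\<in>carrier M. \<forall>y\<in>carrier N. f (pure_tensor R M N x y) = b x y"
proof -
  interpret M: module R M by fact
  interpret N: module R N by fact
  interpret P: module R P by fact
  let ?F = "free_module R (carrier M \<times> carrier N)"
  let ?K = "tensor_kernel R M N"
  interpret F: module R ?F by (rule module_free_module) (rule M.R.is_cring)
  have sK: "submodule ?K R ?F" using assms(1,2) by (rule submodule_tensor_kernel)
  interpret K: submodule ?K R ?F by (rule sK)
  have g: "free_gen R (x, y) \<in> carrier ?F" if "x \<in> carrier M" "y \<in> carrier N" for x y
    using that by (intro free_gen_closed M.R.is_cring) auto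
  obtain \<phi> where \<phi>: "\<phi> \<in> linear_maps R ?F P"
    and \<phi>g: "\<And>x y. x \<in> carrier M \<Longrightarrow> y \<in> carrier N \<Longrightarrow> \<phi> (free_gen R (x, y)) = b x y"
    using free_module_lift[OF assms(3), of "\<lambda>(x, y). b x y" "carrier M \<times> carrier N"] closed
    by (fastforce simp: Pi_iff)
  note L = linear_mapsD[OF \<phi>]
  have minus: "\<phi> (u \<ominus>\<^bsub>?F\<^esub> v) = \<phi> u \<ominus>\<^bsub>P\<^esub> \<phi> v" if "u \<in> carrier ?F" "v \<in> carrier ?F" for u v
  proof -
    have "\<phi> (u \<ominus>\<^bsub>?F\<^esub> v) \<oplus>\<^bsub>P\<^esub> \<phi> v = \<phi> u"
      using that by (subst L(2)[symmetric]) (auto simp: a_minus_def F.M.a_assoc F.M.l_neg)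
    then show ?thesis
      using that L(1) by (metis F.M.minus_closed P.M.minus_eq P.M.add.inv_solve_right)
  qed
  have ker: "submodule {u \<in> carrier ?F. \<phi> u = \<zero>\<^bsub>P\<^esub>} R ?F"
  proof (rule F.submoduleI)
    have "\<phi> \<zero>\<^bsub>?F\<^esub> = \<zero>\<^bsub>P\<^esub>"
      using L(3)[of "\<zero>\<^bsub>R\<^esub>" "\<zero>\<^bsub>?F\<^esub>"] L(1)[of "\<zero>\<^bsub>?F\<^esub>"] by simp
    then show z: "\<zero>\<^bsub>?F\<^esub> \<in> {u \<in> carrier ?F. \<phi> u = \<zero>\<^bsub>P\<^esub>}" by simp
    fix u assume "u \<in> {u \<in> carrier ?F. \<phi> u = \<zero>\<^bsub>P\<^esub>}"
    then show "\<ominus>\<^bsub>?F\<^esub> u \<in> {u \<in> carrier ?F. \<phi> u = \<zero>\<^bsub>P\<^esub>}"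
      using minus[of "\<zero>\<^bsub>?F\<^esub>" u] z by (auto simp: a_minus_def)
  qed (auto simp: L)
  have "tensor_relations R M N \<subseteq> {u \<in> carrier ?F. \<phi> u = \<zero>\<^bsub>P\<^esub>}"
  proof -
    have c: "\<phi> (free_gen R (x, y)) \<in> carrier P" if "x \<in> carrier M" "y \<in> carrier N" for x y
      using g L(1) that by auto
    have "\<phi> u = \<zero>\<^bsub>P\<^esub>" if "u \<in> tensor_relations R M N" for u
      using that unfolding tensor_relations_def Let_def
      by (auto simp: minus L(2,3) g \<phi>g add_left add_right smult_left smult_right closed P.M.r_neg a_minus_def[of P])
    then show ?thesis using tensor_relations_subset[OF assms(1,2)] by auto
  qed
  then have K0: "\<phi> k = \<zero>\<^bsub>P\<^esub>" if "k \<in> ?K" for k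
    using ker that unfolding tensor_kernel_def submodule_span_def by blast
  define f where "f X = \<phi> (SOME u. u \<in> X)" for X
  have fK: "f (?K +>\<^bsub>?F\<^esub> u) = \<phi> u" if u: "u \<in> carrier ?F" for u
  proof -
    have "u \<in> ?K +>\<^bsub>?F\<^esub> u"
      using u K.one_closed by (force simp: a_r_coset_def r_coset_def)
    then have "(SOME v. v \<in> ?K +>\<^bsub>?F\<^esub> u) \<in> ?K +>\<^bsub>?F\<^esub> u" by (rule someI[where P = "\<lambda>v. v \<in> ?K +>\<^bsub>?F\<^esub> u"])
    then obtain k where "k \<in> ?K" "(SOME v. v \<in> ?K +>\<^bsub>?F\<^esub> u) = k \<oplus>\<^bsub>?F\<^esub> u"
      by (auto simp: a_r_coset_def r_coset_def)
    moreover have "k \<in> carrier ?F" using \<open>k \<in> ?K\<close> K.subset by auto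
    ultimately show ?thesis using u by (simp add: f_def L K0)
  qed
  have repr: "\<exists>u\<in>carrier ?F. X = ?K +>\<^bsub>?F\<^esub> u" if "X \<in> carrier (tensor_product R M N)" for X
    using that by (auto simp: tensor_product_def quotient_module_def A_RCOSETS_def RCOSETS_def a_r_coset_def)
  note qa = quotient_add[OF F.module_axioms sK, folded tensor_product_def]
  note qs = quotient_smult[OF F.module_axioms sK, folded tensor_product_def]
  have "f \<in> linear_maps R (tensor_product R M N) P"
    unfolding linear_maps_def by (auto dest!: repr simp: fK qa qs L)
  moreover have "f (pure_tensor R M N x y) = b x y" if "x \<in> carrier M" "y \<in> carrier N" for x y
    using that by (simp add: pure_tensor_def fK g \<phi>g)
  ultimately show ?thesis by blast
qed

end

theory Submission
  imports Defs
begin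

text \<open>
  This is the determinant trick behind Nakayama's lemma. Let \<open>b\<^sub>1\<close>, \<open>b\<^sub>2\<close> generate \<open>A\<close> as a module.
  Surjectivity of the multiplication says that every element is a sum of products \<open>x y\<close>; expanding
  each \<open>y\<close> in the generators and moving the scalars to \<open>x\<close> gives
  \<open>b\<^sub>1 = a\<^sub>1\<^sub>1 b\<^sub>1 + a\<^sub>1\<^sub>2 b\<^sub>2\<close> and \<open>b\<^sub>2 = a\<^sub>2\<^sub>1 b\<^sub>1 + a\<^sub>2\<^sub>2 b\<^sub>2\<close> with coefficients in \<open>A\<close> itself
  (lemma \<open>surjective_imp_combination\<close>). In other words, the matrix \<open>1 - (a\<^sub>i\<^sub>j)\<close>, taken over \<open>A\<close> with
  an identity adjoined, kills the vector \<open>(b\<^sub>1, b\<^sub>2)\<close>, hence so does its determinant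
  \<open>(1 - a\<^sub>1\<^sub>1) (1 - a\<^sub>2\<^sub>2) - a\<^sub>1\<^sub>2 a\<^sub>2\<^sub>1 = 1 - e\<close>. The element
  \<open>e = a\<^sub>1\<^sub>1 + a\<^sub>2\<^sub>2 + a\<^sub>1\<^sub>2 a\<^sub>2\<^sub>1 - a\<^sub>1\<^sub>1 a\<^sub>2\<^sub>2\<close> lies in \<open>A\<close> and fixes both generators, so it fixes
  everything.
\<close>

section \<open>Spanning by pure tensors and by a basis\<close>

text \<open>
  Splitting off one point of the support at a time writes an element of the free module as a
  combination of generators.
\<close>

lemma submodule_free_module_eq:
  assumes "cring R" and H: "submodule H R (free_module R S)"
    and gen: "\<And>s. s \<in> S \<Longrightarrow> free_gen R s \<in> H"
  shows "H = carrier (free_module R S)"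
proof -
  interpret cring R by fact
  let ?F = "free_module R S"
  interpret F: module R ?F using assms(1) by (rule module_free_module)
  note HE = F.submoduleE[OF H]
  have "f \<in> H" if "finite T" "f \<in> carrier ?F" "{s. f s \<noteq> \<zero>\<^bsub>R\<^esub>} \<subseteq> T" for T f
    using that
  proof (induction T arbitrary: f rule: finite_induct)
    case empty
    then have "f = \<zero>\<^bsub>?F\<^esub>" by (auto simp: free_module_def)
    then show ?case
      using subgroup.one_closed[OF submodule.axioms(1)[OF H]] by simp
  next
    case (insert t T)
    show ?case
    proof (cases "t \<in> S")
      case False
      then have "f t = \<zero>\<^bsub>R\<^esub>" using insert.prems(1) by (auto simp: free_module_def)
      then have "{s. f s \<noteq> \<zero>\<^bsub>R\<^esub>} \<subseteq> T" using insert.prems(2) by auto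
      with insert.prems(1) show ?thesis by (rule insert.IH)
    next
      case True
      let ?h = "f(t := \<zero>\<^bsub>R\<^esub>)"
      have car: "f s \<in> carrier R" for s
        using insert.prems(1) by (cases "s \<in> S") (auto simp: free_module_def)
      have "{s. ?h s \<noteq> \<zero>\<^bsub>R\<^esub>} \<subseteq> {s. f s \<noteq> \<zero>\<^bsub>R\<^esub>}" by auto
      moreover have "finite {s. f s \<noteq> \<zero>\<^bsub>R\<^esub>}"
        using insert.prems(1) by (simp add: free_module_def)
      ultimately have "finite {s. ?h s \<noteq> \<zero>\<^bsub>R\<^esub>}" by (rule finite_subset)
      then have "?h \<in> carrier ?F"
        using insert.prems(1) unfolding free_module_def by (simp add: Pi_iff)
      moreover have "{s. ?h s \<noteq> \<zero>\<^bsub>R\<^esub>} \<subseteq> T" using insert.prems(2) by auto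
      ultimately have "?h \<in> H" by (rule insert.IH)
      moreover have "f t \<odot>\<^bsub>?F\<^esub> free_gen R t \<oplus>\<^bsub>?F\<^esub> ?h = f"
        using car by (auto simp: free_module_def free_gen_def)
      ultimately show ?thesis using HE(5)[OF HE(4)[OF car gen[OF True]]] by metis
    qed
  qed
  moreover have "H \<subseteq> carrier ?F" by (rule HE(1))
  ultimately show ?thesis by (auto simp: free_module_def)
qed

text \<open>
  Pure tensors span the tensor product, so a linear map takes values in any submodule that
  contains the images of the pure tensors.
\<close>

lemma linear_map_tensor_product_in_submodule:
  assumes M: "module R M" and N: "module R N" and f: "f \<in> linear_maps R (tensor_product R M N) P"
    and P: "module R P" and I: "submodule I R P"
    and pure: "\<And>x y. \<lbrakk>x \<in> carrier M; y \<in> carrier N\<rbrakk> \<Longrightarrow> f (pure_tensor R M N x y) \<in> I"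
    and u: "u \<in> carrier (tensor_product R M N)"
  shows "f u \<in> I"
proof -
  interpret M: module R M by fact
  interpret P: module R P by fact
  let ?S = "carrier M \<times> carrier N"
  let ?F = "free_module R ?S"
  let ?K = "tensor_kernel R M N"
  interpret F: module R ?F by (rule module_free_module) (rule M.R.is_cring)
  have sK: "submodule ?K R ?F" using M N by (rule submodule_tensor_kernel)
  note qa = quotient_add[OF F.module_axioms sK, folded tensor_product_def]
  note qs = quotient_smult[OF F.module_axioms sK, folded tensor_product_def]
  note L = linear_mapsD[OF f]
  note IE = P.submoduleE[OF I]
  have cl: "?K +>\<^bsub>?F\<^esub> v \<in> carrier (tensor_product R M N)" if "v \<in> carrier ?F" for v
    using that by (auto simp: tensor_product_def quotient_module_def A_RCOSETS_def RCOSETS_def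
        a_r_coset_def)
  let ?H = "{v \<in> carrier ?F. f (?K +>\<^bsub>?F\<^esub> v) \<in> I}"
  have smult: "a \<odot>\<^bsub>?F\<^esub> v \<in> ?H" if "a \<in> carrier R" "v \<in> ?H" for a v
    using that IE(4) by (auto simp: qs[symmetric] L cl)
  have minus_one: "\<ominus>\<^bsub>?F\<^esub> v = (\<ominus>\<^bsub>R\<^esub> \<one>\<^bsub>R\<^esub>) \<odot>\<^bsub>?F\<^esub> v" if "v \<in> carrier ?F" for v
    using that by (simp add: F.smult_l_minus)
  have "submodule ?H R ?F"
  proof (rule F.submoduleI)
    have "\<zero>\<^bsub>R\<^esub> \<odot>\<^bsub>tensor_product R M N\<^esub> (?K +>\<^bsub>?F\<^esub> \<zero>\<^bsub>?F\<^esub>) = ?K +>\<^bsub>?F\<^esub> \<zero>\<^bsub>?F\<^esub>"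
      by (simp add: qs)
    then have "f (?K +>\<^bsub>?F\<^esub> \<zero>\<^bsub>?F\<^esub>) = \<zero>\<^bsub>P\<^esub>"
      using L(3)[of "\<zero>\<^bsub>R\<^esub>" "?K +>\<^bsub>?F\<^esub> \<zero>\<^bsub>?F\<^esub>"] L(1)[of "?K +>\<^bsub>?F\<^esub> \<zero>\<^bsub>?F\<^esub>"] by (simp add: cl)
    then show "\<zero>\<^bsub>?F\<^esub> \<in> ?H"
      using subgroup.one_closed[OF submodule.axioms(1)[OF I]] by simp
    show "\<ominus>\<^bsub>?F\<^esub> v \<in> ?H" if "v \<in> ?H" for v
      using smult[OF _ that, of "\<ominus>\<^bsub>R\<^esub> \<one>\<^bsub>R\<^esub>"] that by (simp add: minus_one)
    show "v \<oplus>\<^bsub>?F\<^esub> w \<in> ?H" if "v \<in> ?H" "w \<in> ?H" for v w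
      using that IE(5) by (auto simp: qa[symmetric] L cl)
    show "a \<odot>\<^bsub>?F\<^esub> v \<in> ?H" if "a \<in> carrier R" "v \<in> ?H" for a v
      using that by (rule smult)
  qed auto
  moreover have "free_gen R s \<in> ?H" if "s \<in> ?S" for s
    using that pure free_gen_closed[OF M.R.is_cring that] by (auto simp: pure_tensor_def)
  ultimately have "?H = carrier ?F"
    by (rule submodule_free_module_eq[OF M.R.is_cring])
  moreover obtain v where "v \<in> carrier ?F" "u = ?K +>\<^bsub>?F\<^esub> v"
    using u by (auto simp: tensor_product_def quotient_module_def A_RCOSETS_def RCOSETS_def
        a_r_coset_def)
  ultimately show ?thesis by blast
qed

lemma free_of_rank_2_generators:
  assumes "module R M" "free_of_rank R M 2"
  obtains b\<^sub>1 b\<^sub>2 where "b\<^sub>1 \<in> carrier M" "b\<^sub>2 \<in> carrier M"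
    "\<And>x. x \<in> carrier M \<Longrightarrow>
      \<exists>r\<in>carrier R. \<exists>s\<in>carrier R. x = r \<odot>\<^bsub>M\<^esub> b\<^sub>1 \<oplus>\<^bsub>M\<^esub> s \<odot>\<^bsub>M\<^esub> b\<^sub>2"
proof -
  interpret module R M by fact
  obtain B where B: "B \<subseteq> carrier M" "card B = 2"
    and ex: "\<forall>x\<in>carrier M. \<exists>!c. c \<in> B \<rightarrow>\<^sub>E carrier R \<and> x = (\<Oplus>\<^bsub>M\<^esub>b\<in>B. c b \<odot>\<^bsub>M\<^esub> b)"
    using assms(2) unfolding free_of_rank_def by (elim exE conjE)
  obtain b\<^sub>1 b\<^sub>2 where b: "B = {b\<^sub>1, b\<^sub>2}" "b\<^sub>1 \<noteq> b\<^sub>2"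
    using B(2) unfolding card_2_iff by blast
  show thesis
  proof (rule that)
    show b12: "b\<^sub>1 \<in> carrier M" "b\<^sub>2 \<in> carrier M" using B b by auto
    fix x assume "x \<in> carrier M"
    then obtain c where c: "c \<in> B \<rightarrow>\<^sub>E carrier R" "x = (\<Oplus>\<^bsub>M\<^esub>b\<in>B. c b \<odot>\<^bsub>M\<^esub> b)"
      by (elim bspec[OF ex, THEN ex1_implies_ex, THEN exE] conjE)
    then have c12: "c b\<^sub>1 \<in> carrier R" "c b\<^sub>2 \<in> carrier R" using b by auto
    then have "x = c b\<^sub>1 \<odot>\<^bsub>M\<^esub> b\<^sub>1 \<oplus>\<^bsub>M\<^esub> c b\<^sub>2 \<odot>\<^bsub>M\<^esub> b\<^sub>2"
      using c(2) b b12 by simp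
    then show "\<exists>r\<in>carrier R. \<exists>s\<in>carrier R. x = r \<odot>\<^bsub>M\<^esub> b\<^sub>1 \<oplus>\<^bsub>M\<^esub> s \<odot>\<^bsub>M\<^esub> b\<^sub>2"
      using c12 by (intro bexI)
  qed
qed

section \<open>The bilinear product of an algebra\<close>

context general_algebra
begin

definition product :: "'a \<Rightarrow> 'a \<Rightarrow> 'a"  (infixl "\<cdot>" 70)
  where "x \<cdot> y = m (pure_tensor R A A x y)"

lemma product_closed [simp]:
  "\<lbrakk>x \<in> carrier A; y \<in> carrier A\<rbrakk> \<Longrightarrow> x \<cdot> y \<in> carrier A"
  unfolding product_def
  by (intro linear_mapsD(1)[OF mult_linear] pure_tensor_closed module_axioms)

lemma product_add_left:
  "\<lbrakk>x \<in> carrier A; x' \<in> carrier A; y \<in> carrier A\<rbrakk> \<Longrightarrow> (x \<oplus>\<^bsub>A\<^esub> x') \<cdot> y = x \<cdot> y \<oplus>\<^bsub>A\<^esub> x' \<cdot> y"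
  unfolding product_def
  by (simp add: pure_tensor_add_left pure_tensor_closed module_axioms linear_mapsD(2)[OF mult_linear])

lemma product_add_right:
  "\<lbrakk>x \<in> carrier A; y \<in> carrier A; y' \<in> carrier A\<rbrakk> \<Longrightarrow> x \<cdot> (y \<oplus>\<^bsub>A\<^esub> y') = x \<cdot> y \<oplus>\<^bsub>A\<^esub> x \<cdot> y'"
  unfolding product_def
  by (simp add: pure_tensor_add_right pure_tensor_closed module_axioms linear_mapsD(2)[OF mult_linear])

lemma product_smult_left:
  "\<lbrakk>a \<in> carrier R; x \<in> carrier A; y \<in> carrier A\<rbrakk> \<Longrightarrow> (a \<odot>\<^bsub>A\<^esub> x) \<cdot> y = a \<odot>\<^bsub>A\<^esub> (x \<cdot> y)"
  unfolding product_def
  by (simp add: pure_tensor_smult_left pure_tensor_closed module_axioms linear_mapsD(3)[OF mult_linear])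

lemma product_smult_right:
  "\<lbrakk>a \<in> carrier R; x \<in> carrier A; y \<in> carrier A\<rbrakk> \<Longrightarrow> x \<cdot> (a \<odot>\<^bsub>A\<^esub> y) = a \<odot>\<^bsub>A\<^esub> (x \<cdot> y)"
  unfolding product_def
  by (simp add: pure_tensor_smult_right pure_tensor_closed module_axioms linear_mapsD(3)[OF mult_linear])

lemma submodule_combinations:
  assumes "b \<in> carrier A" "b' \<in> carrier A"
  shows "submodule {p \<cdot> b \<oplus>\<^bsub>A\<^esub> q \<cdot> b' | p q. p \<in> carrier A \<and> q \<in> carrier A} R A" (is "submodule ?I R A")
proof -
  have smult: "a \<odot>\<^bsub>A\<^esub> v \<in> ?I" if a: "a \<in> carrier R" and "v \<in> ?I" for a v
  proof -
    obtain p q where pq: "p \<in> carrier A" "q \<in> carrier A" "v = p \<cdot> b \<oplus>\<^bsub>A\<^esub> q \<cdot> b'"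
      using \<open>v \<in> ?I\<close> by blast
    then have "a \<odot>\<^bsub>A\<^esub> v = (a \<odot>\<^bsub>A\<^esub> p) \<cdot> b \<oplus>\<^bsub>A\<^esub> (a \<odot>\<^bsub>A\<^esub> q) \<cdot> b'"
      using a assms by (simp add: smult_r_distr product_smult_left)
    then show ?thesis using a pq by blast
  qed
  have car: "?I \<subseteq> carrier A" using assms by auto
  show ?thesis
  proof (rule submoduleI)
    show "?I \<subseteq> carrier A" by (rule car)
    have "\<zero>\<^bsub>R\<^esub> \<odot>\<^bsub>A\<^esub> (\<zero>\<^bsub>A\<^esub> \<cdot> b \<oplus>\<^bsub>A\<^esub> \<zero>\<^bsub>A\<^esub> \<cdot> b') \<in> ?I" by (rule smult) auto
    then show "\<zero>\<^bsub>A\<^esub> \<in> ?I" using assms by simp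
    show "\<ominus>\<^bsub>A\<^esub> v \<in> ?I" if "v \<in> ?I" for v
      using smult[OF _ that, of "\<ominus> \<one>"] subsetD[OF car that] by (simp add: smult_l_minus)
    fix v w assume "v \<in> ?I" "w \<in> ?I"
    then obtain p q p' q' where pq: "p \<in> carrier A" "q \<in> carrier A" "v = p \<cdot> b \<oplus>\<^bsub>A\<^esub> q \<cdot> b'"
      "p' \<in> carrier A" "q' \<in> carrier A" "w = p' \<cdot> b \<oplus>\<^bsub>A\<^esub> q' \<cdot> b'" by blast
    then have "v \<oplus>\<^bsub>A\<^esub> w = (p \<oplus>\<^bsub>A\<^esub> p') \<cdot> b \<oplus>\<^bsub>A\<^esub> (q \<oplus>\<^bsub>A\<^esub> q') \<cdot> b'"
      using assms by (simp add: product_add_left M.a_ac)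
    then show "v \<oplus>\<^bsub>A\<^esub> w \<in> ?I" using pq M.a_closed by blast
  qed (rule smult)
qed

subsection \<open>Coefficients in the algebra and the determinant\<close>

text \<open>
  A product \<open>x \<cdot> (r b\<^sub>1 + s b\<^sub>2)\<close> equals \<open>(r x) \<cdot> b\<^sub>1 + (s x) \<cdot> b\<^sub>2\<close>: the scalar coefficients of the
  second factor are absorbed into the first. So all products, and hence all their sums, have the
  form below.
\<close>

lemma surjective_imp_combination:
  assumes surj: "m ` carrier (tensor_product R A A) = carrier A"
    and b: "b\<^sub>1 \<in> carrier A" "b\<^sub>2 \<in> carrier A"
    and gen: "\<And>x. x \<in> carrier A \<Longrightarrow>
      \<exists>r\<in>carrier R. \<exists>s\<in>carrier R. x = r \<odot>\<^bsub>A\<^esub> b\<^sub>1 \<oplus>\<^bsub>A\<^esub> s \<odot>\<^bsub>A\<^esub> b\<^sub>2"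
    and x: "x \<in> carrier A"
  shows "\<exists>p\<in>carrier A. \<exists>q\<in>carrier A. x = p \<cdot> b\<^sub>1 \<oplus>\<^bsub>A\<^esub> q \<cdot> b\<^sub>2"
proof -
  let ?I = "{p \<cdot> b\<^sub>1 \<oplus>\<^bsub>A\<^esub> q \<cdot> b\<^sub>2 | p q. p \<in> carrier A \<and> q \<in> carrier A}"
  have "m (pure_tensor R A A y z) \<in> ?I" if y: "y \<in> carrier A" and z: "z \<in> carrier A" for y z
  proof -
    obtain r s where rs: "r \<in> carrier R" "s \<in> carrier R" "z = r \<odot>\<^bsub>A\<^esub> b\<^sub>1 \<oplus>\<^bsub>A\<^esub> s \<odot>\<^bsub>A\<^esub> b\<^sub>2"
      using gen[OF z] by blast
    then have "y \<cdot> z = (r \<odot>\<^bsub>A\<^esub> y) \<cdot> b\<^sub>1 \<oplus>\<^bsub>A\<^esub> (s \<odot>\<^bsub>A\<^esub> y) \<cdot> b\<^sub>2"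
      using y b by (simp add: product_add_right product_smult_left product_smult_right)
    then show ?thesis unfolding product_def[symmetric] using rs y smult_closed by blast
  qed
  moreover obtain u where u: "u \<in> carrier (tensor_product R A A)" "x = m u"
    using x surj by blast
  ultimately have "x \<in> ?I"
    using linear_map_tensor_product_in_submodule[OF module_axioms module_axioms mult_linear
        module_axioms submodule_combinations[OF b] _ u(1)] by blast
  then show ?thesis by blast
qed

text \<open>
  Multiplying out the determinant, this is \<open>(1 - e) b = 0\<close> for the first of the two generators.
  With \<open>a\<^sub>1\<^sub>1 a\<^sub>2\<^sub>2\<close> on the other side, no subtraction occurs. Up to commutativity, the hypotheses
  are symmetric under exchanging the indices, so the same identity serves the second generator.
\<close>

lemma determinant_fixes_generator:
  assumes comm: "commutative_algebra R A m" and assoc: "associative_algebra R A m"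
    and car: "b\<^sub>1 \<in> carrier A" "b\<^sub>2 \<in> carrier A" "a\<^sub>1\<^sub>1 \<in> carrier A" "a\<^sub>1\<^sub>2 \<in> carrier A"
      "a\<^sub>2\<^sub>1 \<in> carrier A" "a\<^sub>2\<^sub>2 \<in> carrier A" "e \<in> carrier A"
    and b\<^sub>1: "b\<^sub>1 = a\<^sub>1\<^sub>1 \<cdot> b\<^sub>1 \<oplus>\<^bsub>A\<^esub> a\<^sub>1\<^sub>2 \<cdot> b\<^sub>2" and b\<^sub>2: "b\<^sub>2 = a\<^sub>2\<^sub>1 \<cdot> b\<^sub>1 \<oplus>\<^bsub>A\<^esub> a\<^sub>2\<^sub>2 \<cdot> b\<^sub>2"
    and e: "e \<oplus>\<^bsub>A\<^esub> a\<^sub>1\<^sub>1 \<cdot> a\<^sub>2\<^sub>2 = a\<^sub>1\<^sub>1 \<oplus>\<^bsub>A\<^esub> a\<^sub>2\<^sub>2 \<oplus>\<^bsub>A\<^esub> a\<^sub>1\<^sub>2 \<cdot> a\<^sub>2\<^sub>1"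
  shows "e \<cdot> b\<^sub>1 = b\<^sub>1"
proof -
  have a: "x \<cdot> y \<cdot> z = x \<cdot> (y \<cdot> z)"
    if "x \<in> carrier A" "y \<in> carrier A" "z \<in> carrier A" for x y z
    using assoc that by (simp add: associative_algebra_def product_def)
  have c: "x \<cdot> y = y \<cdot> x" if "x \<in> carrier A" "y \<in> carrier A" for x y
    using comm that by (simp add: commutative_algebra_def product_def)
  have lc: "x \<cdot> (y \<cdot> z) = y \<cdot> (x \<cdot> z)"
    if "x \<in> carrier A" "y \<in> carrier A" "z \<in> carrier A" for x y z
    using that by (metis a c)
  let ?t = "a\<^sub>1\<^sub>1 \<cdot> (a\<^sub>2\<^sub>2 \<cdot> b\<^sub>1)"
  have 1: "a\<^sub>2\<^sub>2 \<cdot> b\<^sub>1 = ?t \<oplus>\<^bsub>A\<^esub> a\<^sub>1\<^sub>2 \<cdot> (a\<^sub>2\<^sub>2 \<cdot> b\<^sub>2)"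
  proof -
    have "a\<^sub>2\<^sub>2 \<cdot> (a\<^sub>1\<^sub>1 \<cdot> b\<^sub>1 \<oplus>\<^bsub>A\<^esub> a\<^sub>1\<^sub>2 \<cdot> b\<^sub>2) = ?t \<oplus>\<^bsub>A\<^esub> a\<^sub>1\<^sub>2 \<cdot> (a\<^sub>2\<^sub>2 \<cdot> b\<^sub>2)"
      using car by (simp add: product_add_right lc[of "a\<^sub>2\<^sub>2" "a\<^sub>1\<^sub>1"] lc[of "a\<^sub>2\<^sub>2" "a\<^sub>1\<^sub>2"])
    then show ?thesis by (simp only: b\<^sub>1[symmetric])
  qed
  have 2: "a\<^sub>1\<^sub>2 \<cdot> b\<^sub>2 = a\<^sub>1\<^sub>2 \<cdot> (a\<^sub>2\<^sub>1 \<cdot> b\<^sub>1) \<oplus>\<^bsub>A\<^esub> a\<^sub>1\<^sub>2 \<cdot> (a\<^sub>2\<^sub>2 \<cdot> b\<^sub>2)"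
  proof -
    have "a\<^sub>1\<^sub>2 \<cdot> (a\<^sub>2\<^sub>1 \<cdot> b\<^sub>1 \<oplus>\<^bsub>A\<^esub> a\<^sub>2\<^sub>2 \<cdot> b\<^sub>2) = a\<^sub>1\<^sub>2 \<cdot> (a\<^sub>2\<^sub>1 \<cdot> b\<^sub>1) \<oplus>\<^bsub>A\<^esub> a\<^sub>1\<^sub>2 \<cdot> (a\<^sub>2\<^sub>2 \<cdot> b\<^sub>2)"
      using car by (simp add: product_add_right)
    then show ?thesis by (simp only: b\<^sub>2[symmetric])
  qed
  have "e \<cdot> b\<^sub>1 \<oplus>\<^bsub>A\<^esub> ?t = (e \<oplus>\<^bsub>A\<^esub> a\<^sub>1\<^sub>1 \<cdot> a\<^sub>2\<^sub>2) \<cdot> b\<^sub>1"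
    using car by (simp add: product_add_left a)
  also have "\<dots> = a\<^sub>1\<^sub>1 \<cdot> b\<^sub>1 \<oplus>\<^bsub>A\<^esub> a\<^sub>2\<^sub>2 \<cdot> b\<^sub>1 \<oplus>\<^bsub>A\<^esub> a\<^sub>1\<^sub>2 \<cdot> (a\<^sub>2\<^sub>1 \<cdot> b\<^sub>1)"
    using car by (simp add: e product_add_left a)
  also have "\<dots> = a\<^sub>1\<^sub>1 \<cdot> b\<^sub>1 \<oplus>\<^bsub>A\<^esub> (?t \<oplus>\<^bsub>A\<^esub> a\<^sub>1\<^sub>2 \<cdot> (a\<^sub>2\<^sub>2 \<cdot> b\<^sub>2)) \<oplus>\<^bsub>A\<^esub> a\<^sub>1\<^sub>2 \<cdot> (a\<^sub>2\<^sub>1 \<cdot> b\<^sub>1)"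
    by (simp only: 1[symmetric])
  also have "\<dots> = a\<^sub>1\<^sub>1 \<cdot> b\<^sub>1 \<oplus>\<^bsub>A\<^esub> (a\<^sub>1\<^sub>2 \<cdot> (a\<^sub>2\<^sub>1 \<cdot> b\<^sub>1) \<oplus>\<^bsub>A\<^esub> a\<^sub>1\<^sub>2 \<cdot> (a\<^sub>2\<^sub>2 \<cdot> b\<^sub>2)) \<oplus>\<^bsub>A\<^esub> ?t"
    using car by (simp add: M.a_ac)
  also have "\<dots> = b\<^sub>1 \<oplus>\<^bsub>A\<^esub> ?t" by (simp only: 2[symmetric] b\<^sub>1[symmetric])
  finally show ?thesis using car by simp
qed

end

section \<open>Existence of the identity\<close>

theorem theorem1p2:
  fixes R :: "('r, 'k) ring_scheme" and A :: "('r, 'a, 'l) module_scheme"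
    and m :: "('a \<times> 'a \<Rightarrow> 'r) set \<Rightarrow> 'a"
  assumes "principal_domain R"
    and "general_algebra R A m"
    and "free_of_rank R A 2"
    and "commutative_algebra R A m"
    and "associative_algebra R A m"
    and "m ` carrier (tensor_product R A A) = carrier A"
  shows "unital_algebra R A m"
proof -
  interpret general_algebra R A m by fact
  note comm = assms(4) and assoc = assms(5) and surj = assms(6)
  obtain b\<^sub>1 b\<^sub>2 where b: "b\<^sub>1 \<in> carrier A" "b\<^sub>2 \<in> carrier A"
    and gen: "\<And>x. x \<in> carrier A \<Longrightarrow>
      \<exists>r\<in>carrier R. \<exists>s\<in>carrier R. x = r \<odot>\<^bsub>A\<^esub> b\<^sub>1 \<oplus>\<^bsub>A\<^esub> s \<odot>\<^bsub>A\<^esub> b\<^sub>2"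
    using free_of_rank_2_generators[OF module_axioms assms(3)] by blast
  have comb: "\<exists>p\<in>carrier A. \<exists>q\<in>carrier A. x = p \<cdot> b\<^sub>1 \<oplus>\<^bsub>A\<^esub> q \<cdot> b\<^sub>2"
    if "x \<in> carrier A" for x
    by (rule surjective_imp_combination[OF surj b gen that])
  obtain a\<^sub>1\<^sub>1 a\<^sub>1\<^sub>2 where a1: "a\<^sub>1\<^sub>1 \<in> carrier A" "a\<^sub>1\<^sub>2 \<in> carrier A"
    and b\<^sub>1: "b\<^sub>1 = a\<^sub>1\<^sub>1 \<cdot> b\<^sub>1 \<oplus>\<^bsub>A\<^esub> a\<^sub>1\<^sub>2 \<cdot> b\<^sub>2"
    using comb[OF b(1)] by blast
  obtain a\<^sub>2\<^sub>1 a\<^sub>2\<^sub>2 where a2: "a\<^sub>2\<^sub>1 \<in> carrier A" "a\<^sub>2\<^sub>2 \<in> carrier A"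
    and b\<^sub>2: "b\<^sub>2 = a\<^sub>2\<^sub>1 \<cdot> b\<^sub>1 \<oplus>\<^bsub>A\<^esub> a\<^sub>2\<^sub>2 \<cdot> b\<^sub>2"
    using comb[OF b(2)] by blast
  have c: "x \<cdot> y = y \<cdot> x" if "x \<in> carrier A" "y \<in> carrier A" for x y
    using comm that by (simp add: commutative_algebra_def product_def)
  define e where "e = a\<^sub>1\<^sub>1 \<oplus>\<^bsub>A\<^esub> a\<^sub>2\<^sub>2 \<oplus>\<^bsub>A\<^esub> a\<^sub>1\<^sub>2 \<cdot> a\<^sub>2\<^sub>1 \<ominus>\<^bsub>A\<^esub> a\<^sub>1\<^sub>1 \<cdot> a\<^sub>2\<^sub>2"
  have e: "e \<in> carrier A" using a1 a2 by (simp add: e_def)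
  have e1: "e \<oplus>\<^bsub>A\<^esub> a\<^sub>1\<^sub>1 \<cdot> a\<^sub>2\<^sub>2 = a\<^sub>1\<^sub>1 \<oplus>\<^bsub>A\<^esub> a\<^sub>2\<^sub>2 \<oplus>\<^bsub>A\<^esub> a\<^sub>1\<^sub>2 \<cdot> a\<^sub>2\<^sub>1"
    using a1 a2 by (simp add: e_def a_minus_def M.a_assoc M.l_neg)
  have e2: "e \<oplus>\<^bsub>A\<^esub> a\<^sub>2\<^sub>2 \<cdot> a\<^sub>1\<^sub>1 = a\<^sub>2\<^sub>2 \<oplus>\<^bsub>A\<^esub> a\<^sub>1\<^sub>1 \<oplus>\<^bsub>A\<^esub> a\<^sub>2\<^sub>1 \<cdot> a\<^sub>1\<^sub>2"
    by (simp only: c[OF a2(2) a1(1)] c[OF a2(1) a1(2)] M.a_comm[OF a2(2) a1(1)] e1)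
  have eb1: "e \<cdot> b\<^sub>1 = b\<^sub>1"
    by (rule determinant_fixes_generator[OF comm assoc b a1 a2 e b\<^sub>1 b\<^sub>2 e1])
  have b\<^sub>1': "b\<^sub>1 = a\<^sub>1\<^sub>2 \<cdot> b\<^sub>2 \<oplus>\<^bsub>A\<^esub> a\<^sub>1\<^sub>1 \<cdot> b\<^sub>1"
    by (rule trans[OF b\<^sub>1 M.a_comm]) (simp_all add: a1 b)
  have b\<^sub>2': "b\<^sub>2 = a\<^sub>2\<^sub>2 \<cdot> b\<^sub>2 \<oplus>\<^bsub>A\<^esub> a\<^sub>2\<^sub>1 \<cdot> b\<^sub>1"
    by (rule trans[OF b\<^sub>2 M.a_comm]) (simp_all add: a2 b)
  have eb2: "e \<cdot> b\<^sub>2 = b\<^sub>2"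
    by (rule determinant_fixes_generator[OF comm assoc b(2,1) a2(2,1) a1(2,1) e b\<^sub>2' b\<^sub>1' e2])
  have "e \<cdot> x = x" if x: "x \<in> carrier A" for x
  proof -
    obtain r s where "r \<in> carrier R" "s \<in> carrier R" "x = r \<odot>\<^bsub>A\<^esub> b\<^sub>1 \<oplus>\<^bsub>A\<^esub> s \<odot>\<^bsub>A\<^esub> b\<^sub>2"
      using gen[OF x] by blast
    then show ?thesis using b e by (simp add: product_add_right product_smult_right eb1 eb2)
  qed
  moreover from this have "x \<cdot> e = x" if "x \<in> carrier A" for x
    using that c[OF that e] by simp
  ultimately show ?thesis
    using e unfolding unital_algebra_def product_def by blast
qed

end
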